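(* Let $\phi \in \mathbb{C}(x)$ have degree $d$, let $p$ be a prime not dividing $d$, and suppose that $\alpha \in \mathbb{P}^1(\mathbb{C})$ is $p$-branch abundant for $\phi$. Then there is exactly one $z \in \phi^{-1}(\alpha)$ with $p \nmid e_\phi(z)$; moreover $\alpha$ is periodic under $\phi$, and $z \in O_\phi(\alpha)$.
   Context: For non-constant $\psi \in \mathbb{C}(x)$, $e_\psi(z)$ denotes the ramification index of $\psi$ at $z \in \mathbb{P}^1(\mathbb{C})$; $\phi^n$ is the $n$-th iterate and $O_\phi(\alpha) = \{\phi^n(\alpha): n\ge 0\}$. For an integer $m \geq 2$, a point $\alpha$ is $m$-branch abundant for $\phi$ if the number of $z \in \phi^{-n}(\alpha)$ with $m \nmid e_{\phi^n}(z)$ is bounded as $n \to \infty$.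
   Formalization: That α is periodic and z ∈ O_φ(α) is claimed only for d ≥ 2, since for d = 1 it fails (φ = x + 1, α = 0, z = −1); that there is exactly one z is claimed for every d. *)

theory Defs
  imports
    "HOL-Computational_Algebra.Computational_Algebra"
    "HOL-Computational_Algebra.Field_as_Ring"
begin

text \<open>
  The field \<open>\<complex>(x)\<close> is the fraction field of \<open>\<complex>[x]\<close>.  The library function \<open>quot_of_fract\<close>
  returns the representative in lowest terms with monic denominator.  (The instances that this
  function needs for \<open>complex poly\<close> come from \<open>Field_as_Ring\<close>.)
\<close>

type_synonym ratfun = "complex poly fract"

definition rnum :: "ratfun \<Rightarrow> complex poly" where
  "rnum f = fst (quot_of_fract f)"

definition rden :: "ratfun \<Rightarrow> complex poly" where
  "rden f = snd (quot_of_fract f)"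

definition rdegree :: "ratfun \<Rightarrow> nat" where
  "rdegree f = max (degree (rnum f)) (degree (rden f))"

definition rconst :: "complex \<Rightarrow> ratfun" where
  "rconst c = to_fract [:c:]"

definition rX :: ratfun where
  "rX = to_fract [:0, 1:]"

text \<open>
  Composition in \<open>\<complex>(x)\<close>: numerator and denominator of \<open>f\<close> are evaluated at the field element \<open>g\<close>.
  For non-constant \<open>g\<close> the denominator below is nonzero.
\<close>

definition rcomp :: "ratfun \<Rightarrow> ratfun \<Rightarrow> ratfun" where
  "rcomp f g = poly (map_poly rconst (rnum f)) g / poly (map_poly rconst (rden f)) g"

definition riter :: "ratfun \<Rightarrow> nat \<Rightarrow> ratfun" where
  "riter f n = (rcomp f ^^ n) rX"

datatype cp1 = Fin complex | Infty

text \<open>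
  The self-map of \<open>P\<^sup>1(\<complex>)\<close> induced by \<open>f\<close>.  In the coordinates \<open>[z : 1]\<close> and \<open>[1 : 0]\<close> it is
  given by the homogenisations of numerator and denominator to degree \<open>rdegree f\<close>; at \<open>[1 : 0]\<close>
  these take as values the coefficients in that degree.
\<close>

definition reval :: "ratfun \<Rightarrow> cp1 \<Rightarrow> cp1" where
  "reval f P = (case P of
      Fin z \<Rightarrow>
        if poly (rden f) z = 0 then Infty else Fin (poly (rnum f) z / poly (rden f) z)
    | Infty \<Rightarrow>
        if coeff (rden f) (rdegree f) = 0 then Infty
        else Fin (coeff (rnum f) (rdegree f) / coeff (rden f) (rdegree f)))"

text \<open>The order of vanishing of \<open>f \<noteq> 0\<close> at \<open>P\<close>, negative at poles.\<close>

definition rord :: "ratfun \<Rightarrow> cp1 \<Rightarrow> int" where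
  "rord f P = (case P of
      Fin z \<Rightarrow> int (order z (rnum f)) - int (order z (rden f))
    | Infty \<Rightarrow> int (degree (rden f)) - int (degree (rnum f)))"

text \<open>
  The ramification index of a non-constant \<open>f\<close> at \<open>P\<close> is the order at \<open>P\<close> of \<open>t \<circ> f\<close>, where \<open>t\<close> is
  a uniformiser at \<open>f(P)\<close>: \<open>t = x - c\<close> if \<open>f(P) = c\<close> is finite, and \<open>t = 1 / x\<close> if \<open>f(P) = \<infinity>\<close>.
\<close>

definition ram_index :: "ratfun \<Rightarrow> cp1 \<Rightarrow> nat" where
  "ram_index f P = nat (case reval f P of
      Fin c \<Rightarrow> rord (f - rconst c) P
    | Infty \<Rightarrow> rord (inverse f) P)"

definition orbit_of :: "ratfun \<Rightarrow> cp1 \<Rightarrow> cp1 set" where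
  "orbit_of f \<alpha> = {reval (riter f n) \<alpha> | n. True}"

definition periodic_pt :: "ratfun \<Rightarrow> cp1 \<Rightarrow> bool" where
  "periodic_pt f \<alpha> \<longleftrightarrow> (\<exists>n\<ge>1. reval (riter f n) \<alpha> = \<alpha>)"

text \<open>
  Finiteness is stated because \<open>card\<close> of an infinite set is \<open>0\<close>; it is automatic for
  non-constant \<open>f\<close>.
\<close>

definition branch_abundant :: "nat \<Rightarrow> ratfun \<Rightarrow> cp1 \<Rightarrow> bool" where
  "branch_abundant m f \<alpha> \<longleftrightarrow>
     (\<exists>B. \<forall>n. let S = {z. reval (riter f n) z = \<alpha> \<and> \<not> m dvd ram_index (riter f n) z}
              in finite S \<and> card S \<le> B)"

end

theory Submission
  imports Defs
begin

text \<open>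
  Call \<open>z\<close> a good preimage of \<open>\<phi>(z)\<close> if \<open>p\<close> does not divide \<open>e\<^sub>\<phi>(z)\<close>.  The ramification indices over
  a point add up to \<open>d\<close>, so every point has a good preimage.  By the chain rule, the points counted
  by branch abundance at level \<open>n\<close> are those reached from \<open>\<alpha>\<close> by \<open>n\<close> good backward steps, so their
  number is nondecreasing in \<open>n\<close>.  Being bounded, it is eventually constant, and from then on every
  point reached has exactly one good preimage.  If \<open>d \<ge> 2\<close>, such a point is a critical value of \<open>\<phi>\<close>,
  so the set of points reached from that level on is finite; \<open>\<phi>\<close> permutes it, and it contains \<open>\<alpha>\<close>,
  because \<open>\<alpha>\<close> is an iterated image of its elements.
\<close>

section \<open>Backward orbits of a self-map along selected preimages\<close>

lemma surj_inverse_branch_periodic: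
  fixes f :: "'a \<Rightarrow> 'a" and G :: "'a \<Rightarrow> bool" and \<alpha> :: 'a
  defines "S \<equiv> \<lambda>n. {z. (f ^^ n) z = \<alpha> \<and> (\<forall>i<n. G ((f ^^ i) z))}"
  assumes ex: "\<And>w. \<exists>z. f z = w \<and> G z"
    and fin_unique: "finite {w. \<exists>!z. f z = w \<and> G z}"
    and bound: "\<And>n. finite (S n) \<and> card (S n) \<le> B"
  shows "(\<exists>!z. f z = \<alpha> \<and> G z) \<and> (\<exists>n\<ge>1. (f ^^ n) \<alpha> = \<alpha>) \<and>
    (\<forall>z. f z = \<alpha> \<and> G z \<longrightarrow> (\<exists>n. z = (f ^^ n) \<alpha>))"
proof -
  \<comment> \<open>The first step from \<open>z\<close> is split off, not the last, so that level
    \<open>Suc n\<close> is pulled back from level \<open>n\<close> by a single application of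
    \<open>f\<close>.\<close>
  have S_Suc: "S (Suc n) = {z. f z \<in> S n \<and> G z}" for n
    unfolding S_def by (auto simp: funpow_Suc_right less_Suc_eq_0_disj simp del: funpow.simps)
  have f_image: "f ` S (Suc n) = S n" for n
  proof
    show "S n \<subseteq> f ` S (Suc n)"
    proof
      fix w assume "w \<in> S n"
      moreover obtain z where "f z = w" "G z"
        using ex by blast
      ultimately show "w \<in> f ` S (Suc n)"
        unfolding S_Suc by blast
    qed
  qed (auto simp: S_Suc)
  have mono: "card (S n) \<le> card (S (Suc n))" for n
    using card_image_le[of "S (Suc n)" f] bound[of "Suc n"] by (simp add: f_image)
  \<comment> \<open>A level of largest cardinality exists because the cardinalities are bounded. The
    bound given to \<open>arg_max_nat_le\<close> is \<open>Suc B\<close> because it has to be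
    strict.\<close>
  define N where "N = (ARG_MAX (\<lambda>n. card (S n)) n. True)"
  have N: "card (S n) \<le> card (S N)" for n
    unfolding N_def by (rule arg_max_nat_le[of _ _ _ "Suc B"]) (use bound in \<open>auto simp: less_Suc_eq_le\<close>)
  have card_eq: "card (S n) = card (S N)" if "n \<ge> N" for n
    using lift_Suc_mono_le[of "\<lambda>n. card (S n)", OF mono that] N[of n] by simp
  have unique: "\<exists>!z. f z = w \<and> G z" if "w \<in> S n" "n \<ge> N" for w n
  proof -
    \<comment> \<open>\<open>f\<close> maps \<open>S (Suc n)\<close> onto \<open>S n\<close>, and
      from level \<open>N\<close> on these finite sets have the same size.\<close>
    have "inj_on f (S (Suc n))"
      using bound[of "Suc n"] card_eq[of n] card_eq[of "Suc n"] that
      by (intro eq_card_imp_inj_on) (simp_all add: f_image)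
    then have "y = z" if "f y = w" "G y" "f z = w" "G z" for y z
      using that \<open>w \<in> S n\<close> by (auto simp: S_Suc inj_on_def)
    with ex[of w] show ?thesis
      by blast
  qed
  define U where "U = (\<Union>n\<in>{N..}. S n)"
  have "finite U"
  proof (rule finite_subset[OF _ fin_unique])
    show "U \<subseteq> {w. \<exists>!z. f z = w \<and> G z}"
      unfolding U_def using unique by blast
  qed
  \<comment> \<open>The union now starts at level \<open>Suc N\<close>, yet \<open>f\<close> maps it
    onto all of \<open>U\<close>. A subset of the finite set \<open>U\<close> with image
    \<open>U\<close> is \<open>U\<close> itself, so \<open>f\<close> permutes
    \<open>U\<close>.\<close>
  define V where "V = (\<Union>n\<in>{N..}. S (Suc n))"
  have "V \<subseteq> U"
    by (force simp: U_def V_def)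
  have "f ` V = U"
    unfolding U_def V_def image_UN f_image ..
  have "V = U"
  proof (rule card_subset_eq[OF \<open>finite U\<close> \<open>V \<subseteq> U\<close>])
    have "card U \<le> card V"
      using card_image_le[of V f] finite_subset[OF \<open>V \<subseteq> U\<close> \<open>finite U\<close>] \<open>f ` V = U\<close> by simp
    then show "card V = card U"
      using card_mono[OF \<open>finite U\<close> \<open>V \<subseteq> U\<close>] by simp
  qed
  then have fU: "f ` U = U"
    using \<open>f ` V = U\<close> by simp
  have bij: "bij_betw f U U"
    using \<open>finite U\<close> fU by (simp add: bij_betw_def eq_card_imp_inj_on)
  have bijn: "bij_betw (f ^^ n) U U" for n
    by (rule bij_betw_funpow[OF bij])
  have periodic: "\<exists>k\<ge>1. (f ^^ k) u = u" if "u \<in> U" for u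
  proof -
    have mem: "(f ^^ n) u \<in> U" for n
      using bijn[of n] that by (auto simp: bij_betw_def)
    have "finite (range (\<lambda>n. (f ^^ n) u))"
      by (rule finite_subset[OF _ \<open>finite U\<close>]) (use mem in blast)
    then have "\<not> inj (\<lambda>n. (f ^^ n) u)"
      using finite_imageD infinite_UNIV_nat by blast
    then obtain i j where "i \<noteq> j" "(f ^^ i) u = (f ^^ j) u"
      unfolding inj_def by blast
    then obtain i j where "i < j" and ij: "(f ^^ i) u = (f ^^ j) u"
      by (cases i j rule: linorder_cases) (auto dest: sym)
    then have "(f ^^ i) ((f ^^ (j - i)) u) = (f ^^ i) u"
      using funpow_add[of i "j - i" f] by simp
    then have "(f ^^ (j - i)) u = u"
      using bijn[of i] mem that by (auto simp: bij_betw_def inj_on_def)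
    then show ?thesis
      using \<open>i < j\<close> by (intro exI[of _ "j - i"]) auto
  qed
  have "S 0 = {\<alpha>}"
    by (auto simp: S_def)
  then have "S N \<noteq> {}"
    using N[of 0] by auto
  then obtain u where "u \<in> S N" by blast
  then have "u \<in> U" "(f ^^ N) u = \<alpha>"
    by (auto simp: U_def S_def)
  then have "\<alpha> \<in> U"
    using bijn[of N] by (auto simp: bij_betw_def)
  then obtain n where n: "n \<ge> N" "\<alpha> \<in> S n"
    by (auto simp: U_def)
  have "\<exists>n. z = (f ^^ n) \<alpha>" if z: "f z = \<alpha>" "G z" for z
  proof -
    have "z \<in> S (Suc n)"
      using z n by (simp add: S_Suc)
    then have "z \<in> U"
      using n by (auto simp: U_def intro!: bexI[of _ "Suc n"])
    \<comment> \<open>The first step of the cycle through \<open>z\<close> leads to \<alpha>, so the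
      remaining \<open>k\<close> steps lead from \<alpha> back to \<open>z\<close>.\<close>
    from periodic[OF this] obtain k where "(f ^^ Suc k) z = z"
      by (auto simp: Suc_le_eq gr0_conv_Suc)
    then have "(f ^^ k) \<alpha> = z"
      using z by (simp add: funpow_Suc_right del: funpow.simps)
    then show ?thesis by blast
  qed
  with unique[OF n(2,1)] periodic[OF \<open>\<alpha> \<in> U\<close>] show ?thesis
    by blast
qed

section \<open>Substitution of a rational function into polynomials\<close>

abbreviation peval :: "complex poly \<Rightarrow> ratfun \<Rightarrow> ratfun" where
  "peval p g \<equiv> poly (map_poly rconst p) g"

lemma rconst_simps [simp]:
  "rconst 0 = 0" "rconst 1 = 1" "rconst (a + b) = rconst a + rconst b" "rconst (a * b) = rconst a * rconst b"
  "rconst (a - b) = rconst a - rconst b" "rconst (- a) = - rconst a"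
  by (simp_all add: rconst_def flip: to_fract_1 to_fract_add to_fract_mult to_fract_diff to_fract_uminus one_pCons)

lemma rconst_eq_iff [simp]: "rconst a = rconst b \<longleftrightarrow> a = b"
  by (simp add: rconst_def)

lemma rconst_eq_0_iff [simp]: "rconst a = 0 \<longleftrightarrow> a = 0"
  by (simp add: rconst_def)

lemma peval_add: "peval (p + q) g = peval p g + peval q g"
proof -
  have "map_poly rconst (p + q) = map_poly rconst p + map_poly rconst q"
    by (simp add: poly_eq_iff coeff_map_poly)
  then show ?thesis by simp
qed

lemma peval_smult: "peval (smult c p) g = rconst c * peval p g"
  by (simp add: map_poly_smult)

lemma peval_diff: "peval (p - q) g = peval p g - peval q g"
  using peval_add[of "p - q" q g] by simp

lemma peval_mult: "peval (p * q) g = peval p g * peval q g"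
  by (induction p) (simp_all add: peval_add peval_smult map_poly_pCons algebra_simps)

lemma peval_prod_mset: "peval (\<Prod>x\<in>#M. F x) g = (\<Prod>x\<in>#M. peval (F x) g)"
  by (induction M) (simp_all add: peval_mult)

section \<open>Lowest terms and orders of vanishing\<close>

lemma ratfun_eq: "f = to_fract (rnum f) / to_fract (rden f)"
  by (metis Fract_conv_to_fract case_prod_unfold quot_to_fract_def quot_to_fract_quot_of_fract rden_def rnum_def)

lemma rden_nonzero [simp]: "rden f \<noteq> 0"
  unfolding rden_def by (transfer) simp

lemma rnum_eq_0_iff [simp]: "rnum f = 0 \<longleftrightarrow> f = 0"
  by (metis ratfun_eq div_0 divide_eq_0_iff rden_nonzero to_fract_eq_0_iff)

lemma rnum_rden_0 [simp]: "rnum 0 = 0" "rden 0 = 1"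
  using quot_of_fract_to_fract[of "0 :: complex poly"] by (simp_all add: rnum_def rden_def)

lemma coprime_rnum_rden: "coprime (rnum f) (rden f)"
  unfolding rnum_def rden_def by transfer (rule coprime_normalize_quot)

text \<open>Frees \<open>rord\<close> from lowest terms: two fractions for the same function agree
  after cross-multiplication, and \<open>order\<close> and \<open>degree\<close> turn products into
  sums.\<close>

lemma rord_quotient:
  assumes "a \<noteq> 0" "b \<noteq> 0"
  shows "rord (to_fract a / to_fract b) P = (case P of Fin z \<Rightarrow> int (order z a) - int (order z b)
    | Infty \<Rightarrow> int (degree b) - int (degree a))"
proof -
  define f :: ratfun where "f = to_fract a / to_fract b"
  have "f \<noteq> 0"
    using assms by (simp add: f_def)
  have "to_fract a / to_fract b = to_fract (rnum f) / to_fract (rden f)"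
    using ratfun_eq[of f] by (simp add: f_def)
  then have eq: "a * rden f = rnum f * b"
    using assms by (simp add: divide_simps flip: to_fract_mult)
  have "int (order z a) + int (order z (rden f)) = int (order z (rnum f)) + int (order z b)" for z
    using arg_cong[OF eq, of "order z"] assms \<open>f \<noteq> 0\<close> by (simp add: order_mult flip: of_nat_add)
  then have "int (order z (rnum f)) - int (order z (rden f)) = int (order z a) - int (order z b)" for z
    by (simp add: algebra_simps)
  moreover have "degree a + degree (rden f) = degree (rnum f) + degree b"
    using arg_cong[OF eq, of degree] assms \<open>f \<noteq> 0\<close> by (simp add: degree_mult_eq)
  then have "int (degree (rden f)) - int (degree (rnum f)) = int (degree b) - int (degree a)"
    by linarith
  ultimately show ?thesis
    unfolding f_def[symmetric] rord_def by (simp split: cp1.split)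
qed

lemma ratfun_quotientE:
  fixes f :: ratfun
  assumes "f \<noteq> 0"
  obtains a b where "a \<noteq> 0" "b \<noteq> 0" "f = to_fract a / to_fract b"
  using that[of "rnum f" "rden f"] assms ratfun_eq[of f] by simp

lemma rord_mult: "f \<noteq> 0 \<Longrightarrow> g \<noteq> 0 \<Longrightarrow> rord (f * g) P = rord f P + rord g P"
proof -
  assume "f \<noteq> 0" "g \<noteq> 0"
  obtain a b where f: "a \<noteq> 0" "b \<noteq> 0" "f = to_fract a / to_fract b"
    using \<open>f \<noteq> 0\<close> by (rule ratfun_quotientE)
  obtain c d where g: "c \<noteq> 0" "d \<noteq> 0" "g = to_fract c / to_fract d"
    using \<open>g \<noteq> 0\<close> by (rule ratfun_quotientE)
  have "f * g = to_fract (a * c) / to_fract (b * d)"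
    by (simp add: f g)
  also have "rord \<dots> P = rord f P + rord g P"
    unfolding f(3) g(3) using f(1,2) g(1,2)
    by (subst (1 2 3) rord_quotient) (auto simp: order_mult degree_mult_eq split: cp1.split)
  finally show ?thesis .
qed

lemma rord_rconst [simp]: "c \<noteq> 0 \<Longrightarrow> rord (rconst c) P = 0"
  using rord_quotient[of "[:c:]" 1 P] by (auto simp: rconst_def order_0I split: cp1.split)

lemma rord_inverse: "f \<noteq> 0 \<Longrightarrow> rord (inverse f) P = - rord f P"
  using rord_mult[of f "inverse f" P] rord_rconst[of 1 P] by simp

lemma rord_divide: "f \<noteq> 0 \<Longrightarrow> g \<noteq> 0 \<Longrightarrow> rord (f / g) P = rord f P - rord g P"
  by (simp add: divide_inverse rord_mult rord_inverse)

lemma rord_prod_mset: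
  "(\<And>x. x \<in># M \<Longrightarrow> F x \<noteq> 0) \<Longrightarrow> rord (\<Prod>x\<in>#M. F x) P = (\<Sum>x\<in>#M. rord (F x) P)"
proof (induction M)
  case (add x M)
  then have "(\<Prod>x\<in>#M. F x) \<noteq> 0"
    by (auto simp: prod_mset_zero_iff)
  with add show ?case
    by (simp add: rord_mult)
qed (use rord_rconst[of 1 P] in simp)

section \<open>Zeros of binary forms on the projective line\<close>

text \<open>The value and the order of vanishing at a point of \<open>P\<^sup>1\<close> of the homogenisation of \<open>p\<close> to degree \<open>d\<close>.\<close>

definition hval :: "nat \<Rightarrow> complex poly \<Rightarrow> cp1 \<Rightarrow> complex" where
  "hval d p P = (case P of Fin z \<Rightarrow> poly p z | Infty \<Rightarrow> coeff p d)"

definition hord :: "nat \<Rightarrow> complex poly \<Rightarrow> cp1 \<Rightarrow> nat" where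
  "hord d p P = (case P of Fin z \<Rightarrow> order z p | Infty \<Rightarrow> d - degree p)"

lemma hord_pos_iff:
  assumes "p \<noteq> 0" "degree p \<le> d"
  shows "hord d p P > 0 \<longleftrightarrow> hval d p P = 0"
proof (cases P)
  case (Fin z)
  then show ?thesis
    using assms by (simp add: hord_def hval_def order_gt_0_iff)
next
  case Infty
  have "degree p < d \<longleftrightarrow> coeff p d = 0"
    using assms by (metis coeff_eq_0 le_neq_implies_less leading_coeff_0_iff)
  then show ?thesis
    using Infty by (simp add: hord_def hval_def)
qed

text \<open>A nonzero form of degree \<open>d\<close> has \<open>d\<close> zeros with multiplicity:
  \<open>degree p\<close> finite ones, as the complex numbers are algebraically closed, and the rest
  at \<open>Infty\<close>.\<close>

lemma sum_hord:
  assumes "p \<noteq> 0" "degree p \<le> d"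
  shows "finite {P. hval d p P = 0}" "(\<Sum>P | hval d p P = 0. hord d p P) = d"
proof -
  let ?R = "{z. poly p z = 0}" and ?I = "if coeff p d = 0 then {Infty} else {}"
  have fin: "finite ?R"
    using assms by (simp add: poly_roots_finite)
  have eq: "{P. hval d p P = 0} = Fin ` ?R \<union> ?I"
  proof (rule set_eqI)
    show "P \<in> {P. hval d p P = 0} \<longleftrightarrow> P \<in> Fin ` ?R \<union> ?I" for P
      by (cases P) (auto simp: hval_def)
  qed
  show "finite {P. hval d p P = 0}"
    using fin unfolding eq by simp
  \<comment> \<open>If \<open>Infty\<close> is not a zero, the sum is empty and
    \<open>degree p = d\<close>.\<close>
  have "(\<Sum>P\<in>?I. hord d p P) = d - degree p"
    using assms hord_pos_iff[OF assms, of Infty] by (auto simp: hord_def hval_def)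
  moreover have "(\<Sum>P\<in>Fin ` ?R. hord d p P) = degree p"
  proof -
    have "(\<Sum>P\<in>Fin ` ?R. hord d p P) = (\<Sum>z\<in>?R. order z p)"
      by (subst sum.reindex) (auto simp: inj_on_def hord_def)
    also have "\<dots> = size (proots p)"
      using assms by (simp add: size_multiset_overloaded_eq)
    finally show ?thesis
      by (simp add: size_proots_complex)
  qed
  ultimately show "(\<Sum>P | hval d p P = 0. hord d p P) = d"
    unfolding eq using fin assms by (subst sum.union_disjoint) auto
qed

section \<open>Fibres and ramification indices as zeros of forms\<close>

text \<open>Read as a form of degree \<open>rdegree f\<close>, for non-constant \<open>f\<close>,
  this is the fibre over \<open>Q\<close> as a divisor: its zeros are the preimages, with their
  ramification indices as multiplicities.\<close>

definition fibre_poly :: "ratfun \<Rightarrow> cp1 \<Rightarrow> complex poly" where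
  "fibre_poly f Q = (case Q of Fin c \<Rightarrow> rnum f - smult c (rden f) | Infty \<Rightarrow> rden f)"

lemma diff_rconst_eq: "f - rconst c = to_fract (rnum f - smult c (rden f)) / to_fract (rden f)"
proof -
  have "smult c (rden f) = [:c:] * rden f" by simp
  then show ?thesis
    by (subst ratfun_eq) (simp add: rconst_def diff_divide_distrib del: mult_pCons_left)
qed

lemma rdegree_rconst [simp]: "rdegree (rconst c) = 0"
  by (simp add: rdegree_def rnum_def rden_def rconst_def)

lemma degree_fibre_poly: "degree (fibre_poly f Q) \<le> rdegree f"
  by (auto simp: fibre_poly_def rdegree_def split: cp1.split intro!: degree_diff_le)

lemma not_rconst: "rdegree f > 0 \<Longrightarrow> f \<noteq> rconst c"
  by auto

lemma fibre_poly_nonzero: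
  assumes "rdegree f > 0"
  shows "fibre_poly f Q \<noteq> 0"
proof (cases Q)
  case (Fin c)
  have "f - rconst c \<noteq> 0"
    using not_rconst[OF assms, of c] by simp
  then show ?thesis
    using Fin by (auto simp: diff_rconst_eq fibre_poly_def)
qed (simp add: fibre_poly_def)

lemma ex_rconst:
  assumes "rdegree f = 0"
  obtains c where "f = rconst c"
proof -
  obtain a b where ab: "rnum f = [:a:]" "rden f = [:b:]"
    using assms by (auto simp: rdegree_def elim!: degree_eq_zeroE)
  with rden_nonzero[of f] have "b \<noteq> 0" by simp
  have "f = rconst a / rconst b"
    using ratfun_eq[of f] ab by (simp add: rconst_def)
  also have "\<dots> = rconst (a / b)"
    using \<open>b \<noteq> 0\<close> by (simp add: divide_simps flip: rconst_simps)
  finally show ?thesis by (rule that)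
qed

text \<open>A finite common zero gives a common linear factor, against coprimality. At
  \<open>Infty\<close>, one of the two polynomials attains degree \<open>rdegree f\<close>.\<close>

lemma no_common_zero:
  assumes "hval (rdegree f) (rnum f) P = 0" "hval (rdegree f) (rden f) P = 0"
  shows False
proof (cases P)
  case (Fin z)
  then have "[:-z, 1:] dvd rnum f" "[:-z, 1:] dvd rden f"
    using assms by (simp_all add: hval_def poly_eq_0_iff_dvd)
  then have "is_unit [:-z, 1:]"
    using coprime_rnum_rden coprime_common_divisor by blast
  then show False
    by (simp add: is_unit_poly_iff)
next
  case Infty
  then have "f \<noteq> 0"
    using assms by (auto simp: hval_def rdegree_def)
  then have "coeff (rden f) (rdegree f) \<noteq> 0 \<or> coeff (rnum f) (rdegree f) \<noteq> 0"
    by (simp add: rdegree_def max_def)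
  then show False
    using assms Infty by (simp add: hval_def)
qed

lemma reval_eq_hval:
  "reval f P = (if hval (rdegree f) (rden f) P = 0 then Infty
     else Fin (hval (rdegree f) (rnum f) P / hval (rdegree f) (rden f) P))"
  by (simp add: reval_def hval_def split: cp1.split)

lemma reval_eq_iff: "reval f P = Q \<longleftrightarrow> hval (rdegree f) (fibre_poly f Q) P = 0"
proof (cases Q)
  case (Fin c)
  have "hval (rdegree f) (fibre_poly f Q) P
      = hval (rdegree f) (rnum f) P - c * hval (rdegree f) (rden f) P"
    by (simp add: Fin fibre_poly_def hval_def split: cp1.split)
  then show ?thesis
    using no_common_zero[of f P] by (auto simp: Fin reval_eq_hval field_simps)
qed (simp add: reval_eq_hval fibre_poly_def)

text \<open>At \<open>Infty\<close> the common degree \<open>d\<close> cancels, and the degree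
  bounds keep the natural subtractions in \<open>hord\<close> from truncating.\<close>

lemma rord_eq_hord:
  assumes "a \<noteq> 0" "b \<noteq> 0" "degree a \<le> d" "degree b \<le> d"
  shows "rord (to_fract a / to_fract b) P = int (hord d a P) - int (hord d b P)"
  using assms by (auto simp: rord_quotient hord_def split: cp1.split)

lemma rord_diff_rconst_hord:
  assumes "rdegree f > 0"
  shows "rord (f - rconst c) P =
    int (hord (rdegree f) (fibre_poly f (Fin c)) P) - int (hord (rdegree f) (fibre_poly f Infty) P)"
proof -
  have "f - rconst c = to_fract (fibre_poly f (Fin c)) / to_fract (fibre_poly f Infty)"
    by (simp add: diff_rconst_eq fibre_poly_def)
  then show ?thesis
    by (simp only: rord_eq_hord fibre_poly_nonzero[OF assms] degree_fibre_poly not_False_eq_True)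
qed

lemma hord_fibre_poly_pos_iff:
  "rdegree f > 0 \<Longrightarrow> hord (rdegree f) (fibre_poly f Q) P > 0 \<longleftrightarrow> reval f P = Q"
  by (simp add: reval_eq_iff hord_pos_iff fibre_poly_nonzero degree_fibre_poly)

lemma hord_fibre_poly_eq_0:
  "rdegree f > 0 \<Longrightarrow> reval f P \<noteq> Q \<Longrightarrow> hord (rdegree f) (fibre_poly f Q) P = 0"
  using hord_fibre_poly_pos_iff by blast

text \<open>The divisor of \<open>f - rconst c\<close> is the fibre over \<open>c\<close> minus the
  fibre over \<open>Infty\<close>, and a fibre that does not contain \<open>P\<close> contributes 0
  at \<open>P\<close>.\<close>

lemma ram_index_eq_hord:
  assumes "rdegree f > 0"
  shows "ram_index f P = hord (rdegree f) (fibre_poly f (reval f P)) P"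
proof (cases "reval f P")
  case (Fin c)
  then show ?thesis
    using assms by (simp add: ram_index_def rord_diff_rconst_hord hord_fibre_poly_eq_0)
next
  case Infty
  have "f \<noteq> 0"
    using not_rconst[OF assms, of 0] by simp
  \<comment> \<open>Writing \<open>f\<close> as \<open>f - rconst 0\<close> brings the pole case
    under \<open>rord_diff_rconst_hord\<close>.\<close>
  then have "rord (inverse f) P = - rord (f - rconst 0) P"
    by (simp add: rord_inverse)
  then show ?thesis
    using assms Infty by (simp add: ram_index_def rord_diff_rconst_hord hord_fibre_poly_eq_0 del: rconst_simps)
qed

lemma ram_index_pos: "rdegree f > 0 \<Longrightarrow> ram_index f P > 0"
  by (simp add: ram_index_eq_hord hord_fibre_poly_pos_iff)

lemma sum_ram_index:
  assumes "rdegree f > 0"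
  shows "finite {P. reval f P = Q}" "(\<Sum>P | reval f P = Q. ram_index f P) = rdegree f"
proof -
  note * = sum_hord[OF fibre_poly_nonzero[OF assms] degree_fibre_poly, of Q, folded reval_eq_iff]
  show "finite {P. reval f P = Q}"
    by (rule *(1))
  have "(\<Sum>P | reval f P = Q. ram_index f P) = (\<Sum>P | reval f P = Q. hord (rdegree f) (fibre_poly f Q) P)"
    by (rule sum.cong) (auto simp: ram_index_eq_hord[OF assms])
  then show "(\<Sum>P | reval f P = Q. ram_index f P) = rdegree f"
    using *(2) by simp
qed

lemma rord_diff_rconst:
  assumes "rdegree f > 0"
  shows "rord (f - rconst c) P = (case reval f P of
    Fin b \<Rightarrow> if c = b then int (ram_index f P) else 0 | Infty \<Rightarrow> - int (ram_index f P))"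
  using assms
  by (auto simp: rord_diff_rconst_hord ram_index_eq_hord hord_fibre_poly_eq_0 split: cp1.split)

section \<open>Orders of compositions and the chain rule\<close>

lemma peval_factored:
  "peval p g = rconst (lead_coeff p) * (\<Prod>x\<in>#proots p. g - rconst x)"
proof -
  have "peval p g = peval (smult (lead_coeff p) (\<Prod>x\<in>#proots p. [:-x, 1:])) g"
    by (simp only: complex_poly_decompose_multiset)
  then show ?thesis
    by (simp add: peval_smult peval_prod_mset map_poly_pCons)
qed

lemma peval_nonzero:
  assumes "rdegree g > 0" "p \<noteq> 0"
  shows "peval p g \<noteq> 0"
  using assms not_rconst[OF assms(1)] by (auto simp: peval_factored prod_mset_zero_iff)

text \<open>A linear factor \<open>g - rconst x\<close> has order \<open>ram_index g P\<close> at
  \<open>P\<close> if \<open>x\<close> is the value there, 0 for other \<open>x\<close> at a finite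
  value, and \<open>- ram_index g P\<close> if \<open>P\<close> is a pole.\<close>

lemma rord_peval:
  assumes "rdegree g > 0" "p \<noteq> 0"
  shows "rord (peval p g) P = int (ram_index g P) *
    (case reval g P of Fin b \<Rightarrow> int (order b p) | Infty \<Rightarrow> - int (degree p))"
proof -
  have "(\<Prod>x\<in>#proots p. g - rconst x) \<noteq> 0"
    using not_rconst[OF assms(1)] by (auto simp: prod_mset_zero_iff)
  then have "rord (peval p g) P = (\<Sum>x\<in>#proots p. rord (g - rconst x) P)"
    using assms not_rconst[OF assms(1)] by (simp add: peval_factored rord_mult rord_prod_mset)
  also have "\<dots> = int (ram_index g P) *
      (case reval g P of Fin b \<Rightarrow> int (count (proots p) b) | Infty \<Rightarrow> - int (size (proots p)))"
  proof (cases "reval g P")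
    case (Fin b)
    have "(\<Sum>x\<in>#M. if x = b then int e else 0) = int e * int (count M b)" for M e
      by (induction M) (auto simp: algebra_simps)
    then show ?thesis
      by (simp add: Fin rord_diff_rconst[OF assms(1)])
  qed (simp add: rord_diff_rconst[OF assms(1)])
  finally show ?thesis
    using assms by (simp add: size_proots_complex split: cp1.split)
qed

text \<open>\<open>rcomp\<close> is defined through lowest terms. Evaluating the cross-multiplied
  identity at \<open>g\<close> extends it to any fraction, since no nonzero polynomial vanishes at a
  non-constant \<open>g\<close>.\<close>

lemma rcomp_quotient:
  assumes "rdegree g > 0" "b \<noteq> 0"
  shows "rcomp (to_fract a / to_fract b) g = peval a g / peval b g"
proof -
  let ?f = "to_fract a / to_fract b"
  have "to_fract a / to_fract b = to_fract (rnum ?f) / to_fract (rden ?f)"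
    by (rule ratfun_eq)
  then have "a * rden ?f = rnum ?f * b"
    using assms by (simp add: divide_simps flip: to_fract_mult)
  from arg_cong[OF this, of "\<lambda>p. peval p g"]
  have "peval a g * peval (rden ?f) g = peval (rnum ?f) g * peval b g"
    by (simp add: peval_mult)
  then show ?thesis
    using peval_nonzero[OF assms(1)] assms by (simp add: rcomp_def divide_simps)
qed

lemma rcomp_nonzero: "rdegree g > 0 \<Longrightarrow> f \<noteq> 0 \<Longrightarrow> rcomp f g \<noteq> 0"
  by (simp add: rcomp_def peval_nonzero)

lemma rcomp_diff_rconst:
  assumes "rdegree g > 0"
  shows "rcomp (f - rconst c) g = rcomp f g - rconst c"
  using assms unfolding diff_rconst_eq[of f]
  by (subst rcomp_quotient)
     (simp_all add: peval_diff peval_smult rcomp_def peval_nonzero diff_divide_distrib)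

lemma rcomp_inverse:
  assumes "rdegree g > 0" "f \<noteq> 0"
  shows "rcomp (inverse f) g = inverse (rcomp f g)"
proof -
  have "inverse f = to_fract (rden f) / to_fract (rnum f)"
    by (subst ratfun_eq) simp
  then show ?thesis
    using assms by (simp add: rcomp_quotient) (simp add: rcomp_def)
qed

lemma rord_rcomp:
  assumes "rdegree g > 0" "f \<noteq> 0"
  shows "rord (rcomp f g) P = int (ram_index g P) * rord f (reval g P)"
  using assms
  by (simp add: rcomp_def rord_divide peval_nonzero rord_peval rord_def[of f] algebra_simps split: cp1.split)

text \<open>If the composite were a constant \<open>c\<close>, the nonzero function
  \<open>f - rconst c\<close> would compose with \<open>g\<close> to 0.\<close>

lemma rdegree_rcomp:
  assumes "rdegree f > 0" "rdegree g > 0"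
  shows "rdegree (rcomp f g) > 0"
proof (rule ccontr)
  assume "\<not> rdegree (rcomp f g) > 0"
  then obtain c where "rcomp f g = rconst c"
    using ex_rconst by blast
  then have "rcomp (f - rconst c) g = 0"
    by (simp add: rcomp_diff_rconst[OF assms(2)])
  then show False
    using rcomp_nonzero[OF assms(2), of "f - rconst c"] not_rconst[OF assms(1), of c] by simp
qed

text \<open>The uniformiser at \<open>Q\<close> composed with \<open>f\<close>, as in the definition
  of \<open>ram_index\<close>, but for a \<open>Q\<close> that need not be the value at the point
  considered.\<close>

definition fibre_fun :: "ratfun \<Rightarrow> cp1 \<Rightarrow> ratfun" where
  "fibre_fun f Q = (case Q of Fin c \<Rightarrow> f - rconst c | Infty \<Rightarrow> inverse f)"

lemma fibre_fun_nonzero: "rdegree f > 0 \<Longrightarrow> fibre_fun f Q \<noteq> 0"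
  using not_rconst[of f 0] not_rconst[of f] by (auto simp: fibre_fun_def split: cp1.split)

lemma rord_fibre_fun:
  assumes "rdegree f > 0"
  shows "rord (fibre_fun f (reval f P)) P = int (ram_index f P)"
    and "rord (fibre_fun f Q) P > 0 \<Longrightarrow> reval f P = Q"
proof -
  have "f \<noteq> 0"
    using not_rconst[OF assms, of 0] by simp
  have inv: "rord (inverse f) P = - rord (f - rconst 0) P"
    using \<open>f \<noteq> 0\<close> by (simp add: rord_inverse)
  show "rord (fibre_fun f (reval f P)) P = int (ram_index f P)"
    using assms inv by (auto simp: fibre_fun_def rord_diff_rconst simp del: rconst_simps split: cp1.split)
  show "reval f P = Q" if "rord (fibre_fun f Q) P > 0"
    using assms inv that by (auto simp: fibre_fun_def rord_diff_rconst simp del: rconst_simps split: cp1.splits if_splits)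
qed

lemma rcomp_fibre_fun:
  assumes "rdegree f > 0" "rdegree g > 0"
  shows "rcomp (fibre_fun f Q) g = fibre_fun (rcomp f g) Q"
  using assms not_rconst[OF assms(1), of 0]
  by (auto simp: fibre_fun_def rcomp_diff_rconst rcomp_inverse split: cp1.split)

text \<open>Both claims come from one order: pulling a uniformiser at
  \<open>reval f (reval g P)\<close> back along \<open>f\<close> and then \<open>g\<close>
  multiplies the two indices. Positivity of this order identifies the value, and then the order is
  the index.\<close>

lemma
  assumes f: "rdegree f > 0" and g: "rdegree g > 0"
  shows reval_rcomp: "reval (rcomp f g) P = reval f (reval g P)"
    and ram_index_rcomp: "ram_index (rcomp f g) P = ram_index g P * ram_index f (reval g P)"
proof -
  have *: "rord (fibre_fun (rcomp f g) (reval f (reval g P))) P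
      = int (ram_index g P) * int (ram_index f (reval g P))"
    using f g by (simp add: rord_rcomp fibre_fun_nonzero rord_fibre_fun(1) flip: rcomp_fibre_fun)
  then show r: "reval (rcomp f g) P = reval f (reval g P)"
    using f g by (intro rord_fibre_fun(2) rdegree_rcomp) (simp_all add: ram_index_pos)
  show "ram_index (rcomp f g) P = ram_index g P * ram_index f (reval g P)"
    using * rord_fibre_fun(1)[OF rdegree_rcomp[OF f g], of P] unfolding r
    by (simp flip: of_nat_mult)
qed

section \<open>Iterates\<close>

lemma rX_simps [simp]: "rnum rX = [:0, 1:]" "rden rX = 1" "rdegree rX = 1"
  by (simp_all add: rX_def rnum_def rden_def rdegree_def)

lemma reval_rX [simp]: "reval rX P = P"
  by (simp add: reval_def split: cp1.split)

lemma ram_index_rX [simp]: "ram_index rX P = 1"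
proof -
  have "order z [:-z, 1:] = 1" for z :: complex
    using order_power_n_n[of z 1] by simp
  then show ?thesis
    by (auto simp: ram_index_eq_hord hord_def fibre_poly_def one_pCons split: cp1.split)
qed

lemma rdegree_riter: "rdegree f > 0 \<Longrightarrow> rdegree (riter f n) > 0"
  unfolding riter_def by (induction n) (simp_all add: rdegree_rcomp)

lemma riter_Suc: "riter f (Suc n) = rcomp f (riter f n)"
  by (simp add: riter_def)

lemma reval_riter:
  assumes "rdegree f > 0"
  shows "reval (riter f n) P = (reval f ^^ n) P"
proof (induction n)
  case (Suc n)
  then show ?case
    using assms by (simp add: riter_Suc reval_rcomp rdegree_riter)
qed (simp add: riter_def)

lemma ram_index_riter:
  assumes "rdegree f > 0"
  shows "ram_index (riter f n) P = (\<Prod>i<n. ram_index f ((reval f ^^ i) P))"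
proof (induction n)
  case (Suc n)
  then show ?case
    using assms by (simp add: riter_Suc ram_index_rcomp rdegree_riter reval_riter)
qed (simp add: riter_def)

text \<open>Primality turns divisibility of the product over an orbit segment into a condition on
  its individual steps.\<close>

lemma prime_dvd_ram_index_riter:
  assumes "rdegree f > 0" "prime p"
  shows "p dvd ram_index (riter f n) P \<longleftrightarrow> (\<exists>i<n. p dvd ram_index f ((reval f ^^ i) P))"
  using assms by (auto simp: ram_index_riter prime_dvd_prod_iff)

section \<open>Finiteness of the set of critical points\<close>

text \<open>The numerator of \<open>f'\<close>, whose roots include all finite critical points, poles or not.\<close>

lemma wronskian_nonzero:
  assumes "rdegree f > 0"
  shows "pderiv (rnum f) * rden f - rnum f * pderiv (rden f) \<noteq> 0"
proof
  assume "pderiv (rnum f) * rden f - rnum f * pderiv (rden f) = 0"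
  then have eq: "pderiv (rnum f) * rden f = rnum f * pderiv (rden f)"
    by simp
  then have "rden f dvd rnum f * pderiv (rden f)"
    by (metis dvd_triv_right)
  \<comment> \<open>In characteristic 0 a polynomial divides its derivative only if it is constant.
    With \<open>rden f\<close> constant, \<open>eq\<close> makes \<open>rnum f\<close> constant
    too.\<close>
  then have "rden f dvd pderiv (rden f)"
    using coprime_rnum_rden coprime_commute coprime_dvd_mult_right_iff by metis
  then have "degree (rden f) = 0"
    using not_dvd_pderiv by blast
  then have "pderiv (rden f) = 0"
    by (simp add: pderiv_eq_0_iff)
  then have "pderiv (rnum f) = 0"
    using eq by simp
  then show False
    using assms \<open>degree (rden f) = 0\<close> by (simp add: rdegree_def pderiv_eq_0_iff)
qed

lemma finite_critical_points:
  assumes "rdegree f > 0"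
  shows "finite {P. ram_index f P \<noteq> 1}"
proof (rule finite_subset)
  let ?W = "pderiv (rnum f) * rden f - rnum f * pderiv (rden f)"
  show "finite (insert Infty (Fin ` {z. poly ?W z = 0}))"
    using poly_roots_finite[OF wronskian_nonzero[OF assms]] by simp
  show "{P. ram_index f P \<noteq> 1} \<subseteq> insert Infty (Fin ` {z. poly ?W z = 0})"
  proof
    fix P assume "P \<in> {P. ram_index f P \<noteq> 1}"
    then have P: "ram_index f P \<noteq> 1" by simp
    show "P \<in> insert Infty (Fin ` {z. poly ?W z = 0})"
    proof (cases P)
      case (Fin z)
      let ?p = "fibre_poly f (reval f P)"
      have "order z ?p \<ge> 2"
        using P ram_index_pos[OF assms, of P] by (simp add: ram_index_eq_hord[OF assms] Fin hord_def)
      then have "[:-z, 1:] ^ 2 dvd ?p"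
        by (simp add: order_divides)
      then obtain q where q: "?p = [:-z, 1:] * ([:-z, 1:] * q)"
        unfolding dvd_def power2_eq_square mult.assoc by blast
      have 0: "poly ?p z = 0" "poly (pderiv ?p) z = 0"
        unfolding q by (simp_all add: pderiv_mult pderiv_pCons del: mult_pCons_left)
      \<comment> \<open>At a finite value \<open>c\<close>, the numerator and its derivative at
        \<open>z\<close> are \<open>c\<close> times those of the denominator, so the two terms of
        \<open>?W\<close> cancel. At a pole, \<open>rden f\<close> and its derivative both vanish at
        \<open>z\<close>.\<close>
      have "poly ?W z = 0"
        using 0 by (cases "reval f P") (auto simp: fibre_poly_def pderiv_diff pderiv_smult)
      then show ?thesis
        using Fin by simp
    qed simp
  qed
qed

section \<open>Preimages with ramification index not divisible by \<open>p\<close>\<close>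

lemma ex_ram_index_not_dvd:
  assumes "\<not> p dvd rdegree f"
  shows "\<exists>P. reval f P = Q \<and> \<not> p dvd ram_index f P"
proof (rule ccontr)
  assume "\<not> ?thesis"
  then have "p dvd (\<Sum>P | reval f P = Q. ram_index f P)"
    by (intro dvd_sum) auto
  \<comment> \<open>Degree 0 cannot occur, since \<open>p\<close> divides 0.\<close>
  then show False
    using assms by (cases "rdegree f > 0") (auto simp: sum_ram_index)
qed

lemma finite_unique_ram_index_not_dvd:
  assumes "rdegree f \<ge> 2"
  shows "finite {Q. \<exists>!P. reval f P = Q \<and> \<not> p dvd ram_index f P}"
proof (rule finite_subset)
  have pos: "rdegree f > 0" using assms by simp
  show "finite (reval f ` {P. ram_index f P \<noteq> 1})"
    by (intro finite_imageI finite_critical_points pos)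
  show "{Q. \<exists>!P. reval f P = Q \<and> \<not> p dvd ram_index f P} \<subseteq> reval f ` {P. ram_index f P \<noteq> 1}"
  proof
    fix Q assume "Q \<in> {Q. \<exists>!P. reval f P = Q \<and> \<not> p dvd ram_index f P}"
    then obtain P where P: "\<And>P'. reval f P' = Q \<and> \<not> p dvd ram_index f P' \<longleftrightarrow> P' = P"
      by auto
    show "Q \<in> reval f ` {P. ram_index f P \<noteq> 1}"
    proof (rule ccontr)
      assume "Q \<notin> reval f ` {P. ram_index f P \<noteq> 1}"
      then have 1: "ram_index f P' = 1" if "reval f P' = Q" for P'
        using that by blast
      \<comment> \<open>The index 1 at \<open>P\<close> is not divisible by \<open>p\<close>, so
        every preimage of \<open>Q\<close> qualifies and hence equals \<open>P\<close>. The fibre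
        sum is then 1, too small for the degree.\<close>
      have "reval f P' = Q \<longleftrightarrow> P' = P" for P'
        using P[of P'] P[of P] 1[of P'] 1[of P] by auto
      then have "{P'. reval f P' = Q} = {P}"
        by simp
      moreover have "(\<Sum>P' | reval f P' = Q. ram_index f P') = (\<Sum>P' | reval f P' = Q. 1)"
        using 1 by (intro sum.cong[OF refl]) blast
      ultimately show False
        using sum_ram_index(2)[OF pos, of Q] assms by simp
    qed
  qed
qed

text \<open>Positive indices with sum 1 leave room for a single point of index 1.\<close>

lemma ram_index_rdegree_1:
  assumes "rdegree f = 1"
  shows "\<exists>!P. reval f P = Q" "ram_index f P = 1"
proof -
  have pos: "rdegree f > 0" using assms by simp
  have sum: "(\<Sum>P | reval f P = Q. ram_index f P) = 1" for Q
    using sum_ram_index(2)[OF pos, of Q] assms by simp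
  have le: "card {P. reval f P = Q} \<le> 1" for Q
    using sum_mono[of "{P. reval f P = Q}" "\<lambda>_. 1" "ram_index f"] ram_index_pos[OF pos] sum[of Q]
    by (simp add: Suc_le_eq)
  moreover have "card {P. reval f P = Q} \<noteq> 0"
  proof
    assume "card {P. reval f P = Q} = 0"
    then have "{P. reval f P = Q} = {}"
      using sum_ram_index(1)[OF pos, of Q] by (simp only: card_0_eq)
    then show False
      using sum[of Q] by (simp only: sum.empty)
  qed
  ultimately have "card {P. reval f P = Q} = 1"
    by (metis le_antisym less_one not_less)
  then obtain R where "{P. reval f P = Q} = {R}"
    by (rule card_1_singletonE)
  then have "reval f P' = Q \<longleftrightarrow> P' = R" for P'
    by (simp add: set_eq_iff)
  then show "\<exists>!P. reval f P = Q"
    by simp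
  have "ram_index f P \<le> 1"
    using member_le_sum[of P "{P'. reval f P' = reval f P}" "ram_index f"] sum sum_ram_index(1)[OF pos] by simp
  then show "ram_index f P = 1"
    using ram_index_pos[OF pos, of P] by simp
qed

text \<open>Periodicity is claimed only from degree 2 on: for the translation \<open>x + 1\<close>
  every point is \<open>p\<close>-branch abundant, but 0 is not periodic and its preimage -1 is not
  in its orbit.\<close>

theorem theorem3p6:
  fixes \<phi> :: ratfun and d p :: nat and \<alpha> :: cp1
  assumes "rdegree \<phi> = d"
    and "prime p"
    and "\<not> p dvd d"
    and "branch_abundant p \<phi> \<alpha>"
  shows "(\<exists>!z. reval \<phi> z = \<alpha> \<and> \<not> p dvd ram_index \<phi> z) \<and>
    (d \<ge> 2 \<longrightarrow> periodic_pt \<phi> \<alpha> \<and>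
      (\<forall>z. reval \<phi> z = \<alpha> \<and> \<not> p dvd ram_index \<phi> z \<longrightarrow> z \<in> orbit_of \<phi> \<alpha>))"
proof (cases "d \<ge> 2")
  case True
  then have pos: "rdegree \<phi> > 0"
    using assms by simp
  obtain B where B: "\<And>n. finite {z. reval (riter \<phi> n) z = \<alpha> \<and> \<not> p dvd ram_index (riter \<phi> n) z}
      \<and> card {z. reval (riter \<phi> n) z = \<alpha> \<and> \<not> p dvd ram_index (riter \<phi> n) z} \<le> B"
    using assms(4) unfolding branch_abundant_def Let_def by blast
  have "(\<exists>!z. reval \<phi> z = \<alpha> \<and> \<not> p dvd ram_index \<phi> z) \<and> (\<exists>n\<ge>1. (reval \<phi> ^^ n) \<alpha> = \<alpha>) \<and>
    (\<forall>z. reval \<phi> z = \<alpha> \<and> \<not> p dvd ram_index \<phi> z \<longrightarrow> (\<exists>n. z = (reval \<phi> ^^ n) \<alpha>))"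
  proof (rule surj_inverse_branch_periodic)
    show "\<exists>z. reval \<phi> z = w \<and> \<not> p dvd ram_index \<phi> z" for w
      using assms by (intro ex_ram_index_not_dvd) simp
    show "finite {w. \<exists>!z. reval \<phi> z = w \<and> \<not> p dvd ram_index \<phi> z}"
      using True assms(1) by (intro finite_unique_ram_index_not_dvd) auto
    show "finite {z. (reval \<phi> ^^ n) z = \<alpha> \<and> (\<forall>i<n. \<not> p dvd ram_index \<phi> ((reval \<phi> ^^ i) z))} \<and>
      card {z. (reval \<phi> ^^ n) z = \<alpha> \<and> (\<forall>i<n. \<not> p dvd ram_index \<phi> ((reval \<phi> ^^ i) z))} \<le> B" for n
      using B[of n] by (simp add: reval_riter[OF pos] prime_dvd_ram_index_riter[OF pos assms(2)])
  qed
  then show ?thesis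
    by (simp add: periodic_pt_def orbit_of_def reval_riter[OF pos])
next
  case False
  \<comment> \<open>\<open>d = 0\<close> is excluded because \<open>p\<close> divides 0.\<close>
  with assms have "d = 1"
    by (cases d) (auto simp: numeral_2_eq_2)
  with assms show ?thesis
    using ram_index_rdegree_1[of \<phi>] by auto
qed

end
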